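(* Let $m\geqslant 2$ and $d\geqslant 2$ be integers, let $f(X)=a_dX^d+\ldots+a_1X+a_0\in\mathbb{Z}_m[X]$ be a polynomial of degree $d$ with $\gcd(a_d,m)=1$, and let $\mathcal{I}=\{1,\ldots,H\}$ with $1\leqslant H\leqslant m$. Then $$T_{f,m}(\mathcal{I})\leqslant\left(\frac{H^4}{m^{4/d(d+1)}}+H^2\right)H^{o(1)}.$$
   Context: $\mathbb{Z}_m$ denotes the residue ring modulo $m$. $T_{f,m}(\mathcal{I})$ is the number of quadruples $(x,y,z,w)\in\mathcal{I}^4$ with $f(x)+f(y)\equiv f(z)+f(w)\pmod m$. The notation $H^{o(1)}$ denotes a factor which, for every fixed $\varepsilon>0$, is at most $C(d,\varepsilon)H^{\varepsilon}$, with $C(d,\varepsilon)$ depending only on $d$ and $\varepsilon$. *)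

theory Defs
  imports "HOL-Computational_Algebra.Polynomial" "HOL-Number_Theory.Cong" Complex_Main
begin

text \<open>
  Polynomials over the residue ring modulo \<open>m\<close> are represented by integer lifts: the congruences
  below depend only on the coefficients of \<open>f\<close> modulo \<open>m\<close>. Every polynomial of degree
  \<open>d\<close> over the residue ring lifts to an integer polynomial of degree \<open>d\<close>; conversely, if
  \<open>m \<ge> 2\<close> and the leading coefficient of an integer polynomial is coprime to \<open>m\<close>, then
  reduction modulo \<open>m\<close> preserves the degree.
\<close>

definition T_count :: "int poly \<Rightarrow> nat \<Rightarrow> int set \<Rightarrow> nat" where
  "T_count f m I =
     card {(x, y, z, w). x \<in> I \<and> y \<in> I \<and> z \<in> I \<and> w \<in> I \<and>
             [poly f x + poly f y = poly f z + poly f w] (mod int m)}"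

end

theory Submission
  imports Defs "HOL-Library.FuncSet" "Jordan_Normal_Form.Determinant"
begin

text \<open>
  Attach to a solution \<open>(x, y, z, w)\<close> in \<open>{1..N}\<close> the vector \<open>v\<close> with
  \<open>v k = x ^ k + y ^ k - z ^ k - w ^ k\<close> for \<open>1 \<le> k \<le> d\<close>. All these vectors are orthogonal modulo
  \<open>m\<close> to the coefficient vector of \<open>f\<close>. If some integer combination of them, with determinants as
  coefficients, were a nonzero multiple \<open>D\<close> of the last unit vector, then \<open>m\<close> would divide \<open>D\<close>, as the
  leading coefficient is a unit; but \<open>D\<close> is at most of order \<open>N ^ (d (d + 1) / 2)\<close>. So for
  \<open>N\<close> below a constant times \<open>m ^ (2 / (d (d + 1)))\<close> there is an integer vector \<open>b\<close> with \<open>b d \<noteq> 0\<close>,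
  of size polynomial in \<open>N\<close>, orthogonal over the integers to all of them. Hence every solution of the
  congruence solves the equation \<open>g x + g y = g z + g w\<close> for the integer polynomial \<open>g\<close> of degree
  \<open>d\<close> with coefficients \<open>b\<close>, and the divisor bound leaves \<open>N ^ (2 + o(1))\<close> solutions. A longer interval is
  cut into blocks of the critical length; by Cauchy-Schwarz the energy of a union of \<open>k\<close> blocks is at most
  \<open>k ^ 4\<close> times the largest energy of a block.
\<close>

subsection \<open>The divisor bound\<close>

text \<open>A divisor of \<open>n\<close> is determined by its exponents at the primes of
  \<open>n\<close>, and the exponent at \<open>p\<close> is at most
  \<open>multiplicity p n\<close>.\<close>

lemma card_divisors_le:
  fixes n :: nat
  assumes "n > 0"
  shows "card {e. e dvd n} \<le> (\<Prod>p\<in>prime_factors n. multiplicity p n + 1)"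
proof -
  let ?P = "prime_factors n"
  let ?g = "\<lambda>e. restrict (\<lambda>p. multiplicity p e) ?P"
  have "inj_on ?g {e. e dvd n}"
  proof (rule inj_onI)
    fix e e' assume e: "e \<in> {e. e dvd n}" "e' \<in> {e. e dvd n}" and eq: "?g e = ?g e'"
    show "e = e'"
    proof (rule multiplicity_eq_nat)
      show "e > 0" "e' > 0" using e assms by (auto intro!: Nat.gr0I)
      fix p :: nat assume p: "prime p"
      show "multiplicity p e = multiplicity p e'"
      proof (cases "p dvd n")
        case True
        then have "p \<in> ?P" using p assms by (simp add: prime_factors_dvd)
        then show ?thesis using fun_cong[OF eq, of p] by simp
      next
        case False
        then have "\<not> p dvd e" "\<not> p dvd e'" using e by (auto dest: dvd_trans)
        then show ?thesis by (simp add: not_dvd_imp_multiplicity_0)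
      qed
    qed
  qed
  moreover have "?g ` {e. e dvd n} \<subseteq> (\<Pi>\<^sub>E p\<in>?P. {..multiplicity p n})"
    using assms by (auto intro!: dvd_imp_multiplicity_le)
  ultimately have "card {e. e dvd n} \<le> card (\<Pi>\<^sub>E p\<in>?P. {..multiplicity p n})"
    by (intro card_inj_on_le[of ?g]) (auto intro!: finite_PiE)
  then show ?thesis by (simp add: card_PiE)
qed

text \<open>Exponential growth beats polynomial growth. This pays for the small primes in the
  divisor bound, where only \<open>p \<ge> 2\<close> is available.\<close>

lemma power_le_const_mult_pow2:
  fixes k :: nat
  shows "\<exists>c\<ge>1::nat. \<forall>a. (a + 1) ^ k \<le> c * 2 ^ a"
proof (cases "k = 0")
  case True
  then show ?thesis by (intro exI[of _ 1]) auto
next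
  case False
  \<comment> \<open>This \<open>t\<close> makes \<open>exp t ^ k = 2\<close>. The k-th power of
    \<open>u \<le> exp u\<close> at \<open>u = t * (a + 1)\<close> then compares
    \<open>(a + 1) ^ k\<close> with \<open>2 ^ (a + 1)\<close>.\<close>
  define t where "t = ln 2 / real k"
  have t: "t > 0" "exp t ^ k = 2" using False by (auto simp: t_def exp_of_nat_mult[symmetric])
  define c where "c = nat \<lceil>max 1 (2 / t ^ k)\<rceil>"
  have c: "max 1 (2 / t ^ k) \<le> real c" unfolding c_def by linarith
  have "(a + 1) ^ k \<le> c * 2 ^ a" for a
  proof -
    have "t * real (a + 1) \<le> exp (real (a + 1) * t)"
      using exp_ge_add_one_self[of "real (a + 1) * t"] unfolding mult.commute[of t] by linarith
    also have "\<dots> = exp t ^ (a + 1)" by (rule exp_of_nat_mult)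
    finally have "(t * real (a + 1)) ^ k \<le> (exp t ^ (a + 1)) ^ k"
      using t by (intro power_mono) auto
    also have "\<dots> = (exp t ^ k) ^ (a + 1)" by (simp only: power_mult[symmetric] mult.commute[of k])
    finally have "t ^ k * real (a + 1) ^ k \<le> 2 * 2 ^ a"
      by (simp only: power_mult_distrib t(2) power_add power_one_right mult.commute)
    then have "real (a + 1) ^ k \<le> 2 * 2 ^ a / t ^ k"
      using t(1) by (simp only: pos_le_divide_eq zero_less_power mult.commute)
    then have "real (a + 1) ^ k \<le> 2 / t ^ k * 2 ^ a" by simp
    also have "\<dots> \<le> real c * 2 ^ a" using c by (intro mult_right_mono) auto
    finally have "real ((a + 1) ^ k) \<le> real (c * 2 ^ a)" by simp
    then show ?thesis by (simp only: of_nat_le_iff)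
  qed
  moreover have "c \<ge> 1" using c by simp
  ultimately show ?thesis by blast
qed

text \<open>A prime \<open>p \<ge> 2 ^ k\<close> satisfies \<open>(a + 1) ^ k \<le> p ^ a\<close>, so only boundedly many primes
  cost a constant factor.\<close>

lemma card_divisors_power_le:
  fixes k :: nat
  shows "\<exists>C\<ge>1::nat. \<forall>n>0. card {e. e dvd n} ^ k \<le> C * n"
proof -
  obtain c :: nat where c: "c \<ge> 1" "\<And>a. (a + 1) ^ k \<le> c * 2 ^ a" using power_le_const_mult_pow2 by blast
  have "card {e. e dvd n} ^ k \<le> c ^ 2 ^ k * n" if n: "n > 0" for n
  proof -
    let ?P = "prime_factors n"
    define u where "u p = (if p < 2 ^ k then c else 1)" for p :: nat
    have "(multiplicity p n + 1) ^ k \<le> u p * p ^ multiplicity p n" if "p \<in> ?P" for p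
    proof (cases "p < 2 ^ k")
      case True
      have "p \<ge> 2" using that by (auto intro: prime_ge_2_nat)
      have "(multiplicity p n + 1) ^ k \<le> c * 2 ^ multiplicity p n" by (rule c(2))
      also have "\<dots> \<le> c * p ^ multiplicity p n"
        using \<open>p \<ge> 2\<close> by (intro mult_le_mono le_refl power_mono) auto
      also have "c = u p" using True by (simp add: u_def)
      finally show ?thesis .
    next
      case False
      have "multiplicity p n + 1 \<le> 2 ^ multiplicity p n"
        by (metis Suc_eq_plus1 Suc_leI less_exp)
      then have "(multiplicity p n + 1) ^ k \<le> (2 ^ multiplicity p n) ^ k"
        by (intro power_mono) auto
      also have "\<dots> = (2 ^ k) ^ multiplicity p n" by (simp add: power_mult[symmetric] mult.commute)
      also have "\<dots> \<le> p ^ multiplicity p n" using False by (intro power_mono) auto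
      finally show ?thesis using False by (simp add: u_def)
    qed
    then have "(\<Prod>p\<in>?P. multiplicity p n + 1) ^ k \<le> (\<Prod>p\<in>?P. u p * p ^ multiplicity p n)"
      unfolding prod_power_distrib by (intro prod_mono) auto
    also have "\<dots> = (\<Prod>p\<in>?P. u p) * n"
      using prime_factorization_nat[OF n] by (simp add: prod.distrib)
    also have "(\<Prod>p\<in>?P. u p) \<le> c ^ 2 ^ k"
    proof -
      have "(\<Prod>p\<in>?P. u p) = (\<Prod>p\<in>?P \<inter> {..<2 ^ k}. c)"
        by (intro prod.mono_neutral_cong_right) (auto simp: u_def)
      also have "\<dots> \<le> c ^ 2 ^ k"
        using card_mono[of "{..<2 ^ k::nat}" "?P \<inter> {..<2 ^ k}"] c(1)
        by (auto intro!: power_increasing)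
      finally show ?thesis .
    qed
    finally have "(\<Prod>p\<in>?P. multiplicity p n + 1) ^ k \<le> c ^ 2 ^ k * n" by simp
    moreover have "card {e. e dvd n} ^ k \<le> (\<Prod>p\<in>?P. multiplicity p n + 1) ^ k"
      by (intro power_mono card_divisors_le n) auto
    ultimately show ?thesis by linarith
  qed
  then show ?thesis using c(1) by (intro exI[of _ "c ^ 2 ^ k"]) auto
qed

lemma card_divisors_powr_bound:
  fixes \<delta> :: real
  assumes "\<delta> > 0"
  shows "\<exists>C>0. \<forall>n>0. real (card {e::nat. e dvd n}) \<le> C * real n powr \<delta>"
proof -
  obtain k :: nat where k: "k > 0" "1 / real k < \<delta>"
    using assms by (metis reals_Archimedean inverse_eq_divide zero_less_Suc)
  obtain C :: nat where C: "C \<ge> 1" "\<And>n. n > 0 \<Longrightarrow> card {e. e dvd n} ^ k \<le> C * n"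
    using card_divisors_power_le by blast
  have "real (card {e::nat. e dvd n}) \<le> real C powr (1 / k) * real n powr \<delta>" if "n > 0" for n
  proof -
    let ?t = "real (card {e::nat. e dvd n})"
    have "card {e::nat. e dvd n} > 0" using that by (subst card_gt_0_iff) auto
    then have "?t = (?t ^ k) powr (1 / k)"
      using k by (simp add: powr_realpow[symmetric] powr_powr)
    also have "\<dots> \<le> (real C * real n) powr (1 / k)"
      using C(2)[OF that] by (intro powr_mono2) (auto simp: of_nat_mult[symmetric] of_nat_power[symmetric] simp del: of_nat_mult of_nat_power)
    also have "\<dots> = real C powr (1 / k) * real n powr (1 / k)" by (simp add: powr_mult)
    also have "\<dots> \<le> real C powr (1 / k) * real n powr \<delta>"
      using that k by (intro mult_left_mono powr_mono) auto
    finally show ?thesis .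
  qed
  then show ?thesis using C(1) by (intro exI[of _ "real C powr (1 / k)"]) auto
qed

subsection \<open>Energy of a union of intervals\<close>

text \<open>Sorting by the common value \<open>n\<close>, the three counts are sums of
  \<open>r n * s n\<close>, \<open>r n * r n\<close> and \<open>s n * s n\<close> over the fibre
  sizes. The claim is \<open>2 * r * s \<le> r * r + s * s\<close>, summed: Cauchy-Schwarz in
  additive form.\<close>

lemma card_collisions_le:
  fixes p :: "'a \<Rightarrow> 'c" and q :: "'b \<Rightarrow> 'c"
  assumes "finite P" "finite Q"
  shows "2 * card {(a, b). a \<in> P \<and> b \<in> Q \<and> p a = q b}
    \<le> card {(a, a'). a \<in> P \<and> a' \<in> P \<and> p a = p a'} + card {(b, b'). b \<in> Q \<and> b' \<in> Q \<and> q b = q b'}"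
proof -
  define R where "R = p ` P \<union> q ` Q"
  define r where "r n = card {a \<in> P. p a = n}" for n
  define s where "s n = card {b \<in> Q. q b = n}" for n
  have fin: "finite R" using assms by (simp add: R_def)
  have count: "card {(a, b). a \<in> X \<and> b \<in> Y \<and> f a = g b}
      = (\<Sum>n\<in>R. card {a \<in> X. f a = n} * card {b \<in> Y. g b = n})"
    if "finite X" "finite Y" "f ` X \<subseteq> R"
    for X :: "'x set" and Y :: "'y set" and f :: "'x \<Rightarrow> 'c" and g :: "'y \<Rightarrow> 'c"
  proof -
    have "{(a, b). a \<in> X \<and> b \<in> Y \<and> f a = g b} = (\<Union>n\<in>R. {a \<in> X. f a = n} \<times> {b \<in> Y. g b = n})"
      using that by auto
    also have "card \<dots> = (\<Sum>n\<in>R. card ({a \<in> X. f a = n} \<times> {b \<in> Y. g b = n}))"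
      using that fin by (intro card_UN_disjoint) auto
    finally show ?thesis by (simp add: card_cartesian_product)
  qed
  have "2 * (r n * s n) \<le> r n * r n + s n * s n" for n
  proof -
    have "0 \<le> (int (r n) - int (s n))\<^sup>2" by simp
    then have "int (2 * (r n * s n)) \<le> int (r n * r n + s n * s n)"
      by (simp add: power2_eq_square algebra_simps)
    then show ?thesis by (simp only: of_nat_le_iff)
  qed
  then have "(\<Sum>n\<in>R. 2 * (r n * s n)) \<le> (\<Sum>n\<in>R. r n * r n + s n * s n)" by (intro sum_mono)
  moreover have "card {(a, b). a \<in> P \<and> b \<in> Q \<and> p a = q b} = (\<Sum>n\<in>R. r n * s n)"
    unfolding r_def s_def by (intro count assms) (auto simp: R_def)
  moreover have "card {(a, a'). a \<in> P \<and> a' \<in> P \<and> p a = p a'} = (\<Sum>n\<in>R. r n * r n)"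
    unfolding r_def by (intro count assms) (auto simp: R_def)
  moreover have "card {(b, b'). b \<in> Q \<and> b' \<in> Q \<and> q b = q b'} = (\<Sum>n\<in>R. s n * s n)"
    unfolding s_def by (intro count assms) (auto simp: R_def)
  ultimately show ?thesis by (simp add: sum.distrib sum_distrib_left)
qed

text \<open>The mixed form of \<open>T_count\<close>: cutting an interval into blocks produces
  quadruples whose entries lie in four different blocks.\<close>

definition energy4 :: "int poly \<Rightarrow> nat \<Rightarrow> int set \<Rightarrow> int set \<Rightarrow> int set \<Rightarrow> int set \<Rightarrow> nat" where
  "energy4 f m A B C D = card {(x, y, z, w). x \<in> A \<and> y \<in> B \<and> z \<in> C \<and> w \<in> D \<and>
     [poly f x + poly f y = poly f z + poly f w] (mod int m)}"

text \<open>Rewriting the congruence as \<open>f x - f z = f w - f y\<close> puts the variables from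
  \<open>A\<close> on one side and those from \<open>B\<close> on the other, so a collision count
  separates the two sets.\<close>

lemma energy4_pairs_le:
  assumes "finite A" "finite B"
  shows "2 * energy4 f m A B A B \<le> T_count f m A + T_count f m B"
proof -
  let ?p = "\<lambda>(x, z). (poly f x - poly f z) mod int m"
  let ?q = "\<lambda>(y, w). (poly f w - poly f y) mod int m"
  have c: "[a + b = c + d] (mod k) \<longleftrightarrow> (a - c) mod k = (d - b) mod k" for a b c d k :: int
    by (simp add: cong_def[symmetric] cong_iff_dvd_diff algebra_simps)
  have c': "[a + b = c + d] (mod k) \<longleftrightarrow> (c - b) mod k = (a - d) mod k" for a b c d k :: int
    unfolding cong_def[symmetric] by (auto simp: cong_iff_dvd_diff algebra_simps dvd_diff_commute)
  have "energy4 f m A B A B = card {(u, v). u \<in> A \<times> A \<and> v \<in> B \<times> B \<and> ?p u = ?q v}"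
    unfolding energy4_def
    by (rule bij_betw_same_card[of "\<lambda>(x, y, z, w). ((x, z), (y, w))"],
        rule bij_betw_byWitness[where f' = "\<lambda>((x, z), (y, w)). (x, y, z, w)"])
      (auto simp: c)
  \<comment> \<open>The second pair is read as \<open>(w, y)\<close>, so that \<open>?p\<close>
    gives \<open>f w - f y\<close> on it. For \<open>B\<close> below, the first pair is swapped
    instead, to suit the sign of \<open>?q\<close>.\<close>
  moreover have "T_count f m A = card {(u, v). u \<in> A \<times> A \<and> v \<in> A \<times> A \<and> ?p u = ?p v}"
    unfolding T_count_def
    by (rule bij_betw_same_card[of "\<lambda>(x, y, z, w). ((x, z), (w, y))"],
        rule bij_betw_byWitness[where f' = "\<lambda>((x, z), (w, y)). (x, y, z, w)"])
      (auto simp: c)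
  moreover have "T_count f m B = card {(u, v). u \<in> B \<times> B \<and> v \<in> B \<times> B \<and> ?q u = ?q v}"
    unfolding T_count_def
    by (rule bij_betw_same_card[of "\<lambda>(x, y, z, w). ((z, x), (y, w))"],
        rule bij_betw_byWitness[where f' = "\<lambda>((z, x), (y, w)). (x, y, z, w)"])
      (auto simp: c)
  ultimately show ?thesis
    using card_collisions_le[of "A \<times> A" "B \<times> B" ?p ?q] assms by simp
qed

text \<open>A first Cauchy-Schwarz on the sums \<open>f x + f y\<close> and \<open>f z + f w\<close>
  separates \<open>A, B\<close> from \<open>C, D\<close>; a second one, on differences, separates
  the sets within each pair.\<close>

lemma energy4_le:
  assumes "finite A" "finite B" "finite C" "finite D"
    and "T_count f m A \<le> M" "T_count f m B \<le> M" "T_count f m C \<le> M" "T_count f m D \<le> M"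
  shows "energy4 f m A B C D \<le> M"
proof -
  let ?s = "\<lambda>(x, y). (poly f x + poly f y) mod int m"
  have split: "energy4 f m A B C D = card {(u, v). u \<in> A \<times> B \<and> v \<in> C \<times> D \<and> ?s u = ?s v}"
    for A B C D
    unfolding energy4_def
    by (rule bij_betw_same_card[of "\<lambda>(x, y, z, w). ((x, y), (z, w))"],
        rule bij_betw_byWitness[where f' = "\<lambda>((x, y), (z, w)). (x, y, z, w)"])
      (auto simp: cong_def)
  have "2 * energy4 f m A B C D \<le> energy4 f m A B A B + energy4 f m C D C D"
    unfolding split using assms(1-4) by (intro card_collisions_le) auto
  then show ?thesis
    using energy4_pairs_le[OF assms(1,2), of f m] energy4_pairs_le[OF assms(3,4), of f m]
      assms(5-8) by linarith
qed

lemma T_count_cover: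
  assumes "finite K" "\<And>i. i \<in> K \<Longrightarrow> finite (J i)" "I \<subseteq> (\<Union>i\<in>K. J i)"
    and "\<And>i. i \<in> K \<Longrightarrow> T_count f m (J i) \<le> M"
  shows "T_count f m I \<le> card K ^ 4 * M"
proof -
  let ?S = "\<lambda>(a, b, c, d). {(x, y, z, w). x \<in> J a \<and> y \<in> J b \<and> z \<in> J c \<and> w \<in> J d \<and>
     [poly f x + poly f y = poly f z + poly f w] (mod int m)}"
  let ?K = "K \<times> K \<times> K \<times> K"
  have fin: "finite (?S t)" if "t \<in> ?K" for t
  proof -
    obtain a b c d where t: "t = (a, b, c, d)" by (cases t)
    have "?S t \<subseteq> J a \<times> J b \<times> J c \<times> J d" by (auto simp: t)
    then show ?thesis using that assms(2) t by (auto intro: finite_subset)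
  qed
  have "T_count f m I \<le> card (\<Union>t\<in>?K. ?S t)"
    unfolding T_count_def
  proof (rule card_mono)
    show "finite (\<Union>t\<in>?K. ?S t)" using assms(1) fin by blast
    show "{(x, y, z, w). x \<in> I \<and> y \<in> I \<and> z \<in> I \<and> w \<in> I \<and>
             [poly f x + poly f y = poly f z + poly f w] (mod int m)} \<subseteq> (\<Union>t\<in>?K. ?S t)"
    proof clarify
      fix x y z w assume *: "x \<in> I" "y \<in> I" "z \<in> I" "w \<in> I"
        "[poly f x + poly f y = poly f z + poly f w] (mod int m)"
      then obtain a b c d where "a \<in> K" "x \<in> J a" "b \<in> K" "y \<in> J b" "c \<in> K" "z \<in> J c"
        "d \<in> K" "w \<in> J d" using assms(3) by (metis UN_E subsetD)
      with * show "(x, y, z, w) \<in> (\<Union>t\<in>?K. ?S t)" by (intro UN_I[of "(a, b, c, d)"]) auto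
    qed
  qed
  also have "\<dots> \<le> (\<Sum>t\<in>?K. card (?S t))" using assms(1) by (intro card_UN_le) auto
  also have "\<dots> \<le> (\<Sum>t\<in>?K. M)"
  proof (rule sum_mono)
    fix t assume t: "t \<in> ?K"
    obtain a b c d where "t = (a, b, c, d)" by (cases t)
    then show "card (?S t) \<le> M"
      using t energy4_le[of "J a" "J b" "J c" "J d" f m M] assms(2,4) by (simp add: energy4_def)
  qed
  also have "\<dots> = card K ^ 4 * M" by (simp add: card_cartesian_product power4_eq_xxxx mult.assoc)
  finally show ?thesis .
qed

text \<open>A block anywhere on the line becomes an initial interval once \<open>f\<close> is
  composed with a translation, so bounds uniform in \<open>f\<close> apply to every block.\<close>

lemma T_count_shift:
  "T_count f m {s + 1..s + n} = T_count (pcompose f [:s, 1:]) m {1..n}"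
  unfolding T_count_def
  by (rule bij_betw_same_card[of "\<lambda>(x, y, z, w). (x - s, y - s, z - s, w - s)"],
      rule bij_betw_byWitness[where f' = "\<lambda>(x, y, z, w). (x + s, y + s, z + s, w + s)"])
    (auto simp: poly_pcompose algebra_simps)

subsection \<open>Small integer vectors orthogonal to a set of vectors\<close>

text \<open>The minor with rows \<open>v 0, ..., v (r - 1)\<close> and columns
  \<open>c 0, ..., c (r - 1)\<close>. Choosing rows and columns by functions turns bordering into a
  function update.\<close>

definition minor :: "(nat \<Rightarrow> nat \<Rightarrow> 'a::comm_ring_1) \<Rightarrow> (nat \<Rightarrow> nat) \<Rightarrow> nat \<Rightarrow> 'a" where
  "minor v c r = det (mat r r (\<lambda>(i, j). v i (c j)))"

text \<open>The cofactors do not involve \<open>w\<close>: the bordered minor is a fixed linear form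
  in the new row, whose coefficients later yield the annihilator.\<close>

lemma minor_expand_last_row:
  "minor (v(r := w)) c (Suc r)
    = (\<Sum>j<Suc r. w (c j) * ((-1) ^ (r + j) * minor v (\<lambda>x. c (if x < j then x else Suc x)) r))"
proof -
  let ?A = "mat (Suc r) (Suc r) (\<lambda>(i, j). (v(r := w)) i (c j))"
  have "mat_delete ?A r j = mat r r (\<lambda>(i, x). v i (c (if x < j then x else Suc x)))"
    if "j < Suc r" for j
    using that by (intro eq_matI) (auto simp: mat_delete_def)
  then show ?thesis
    unfolding minor_def by (subst laplace_expansion_row[of ?A "Suc r" r]) (auto simp: cofactor_def)
qed

text \<open>The cofactors do not depend on \<open>k\<close>, so one combination of the rows
  evaluates the bordered minors for all last columns at once.\<close>

lemma minor_expand_last_col: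
  "minor v (c(r := k)) (Suc r)
    = (\<Sum>i<Suc r. v i k * ((-1) ^ (i + r) * minor (\<lambda>x. v (if x < i then x else Suc x)) c r))"
proof -
  let ?A = "mat (Suc r) (Suc r) (\<lambda>(i, j). v i ((c(r := k)) j))"
  have "mat_delete ?A i r = mat r r (\<lambda>(x, j). v (if x < i then x else Suc x) (c j))"
    if "i < Suc r" for i
    using that by (intro eq_matI) (auto simp: mat_delete_def)
  then show ?thesis
    unfolding minor_def by (subst laplace_expansion_column[of ?A "Suc r" r]) (auto simp: cofactor_def)
qed

lemma minor_cong:
  "(\<And>i. i < r \<Longrightarrow> v i = v' i) \<Longrightarrow> (\<And>j. j < r \<Longrightarrow> c j = c' j) \<Longrightarrow> minor v c r = minor v' c' r"
  unfolding minor_def by (intro arg_cong[of _ _ det] eq_matI) auto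

lemma inj_on_if_minor_nonzero:
  assumes "minor v c r \<noteq> 0"
  shows "inj_on c {..<r}"
proof (rule ccontr)
  assume "\<not> inj_on c {..<r}"
  then obtain i j where ij: "i < r" "j < r" "i \<noteq> j" "c i = c j" by (auto simp: inj_on_def)
  let ?A = "mat r r (\<lambda>(i, j). v i (c j))"
  have "det ?A = 0"
    by (rule det_identical_columns[of ?A r i j]) (use ij in \<open>auto intro!: eq_vecI\<close>)
  with assms show False by (simp add: minor_def)
qed

text \<open>Each of the \<open>fact r\<close> Leibniz terms takes one entry from each of
  \<open>r\<close> distinct columns. Every \<open>B k\<close> thus occurs at most once, and
  \<open>B k \<ge> 1\<close> allows the product to be extended to all of \<open>J\<close>.\<close>

lemma minor_bound:
  fixes v :: "nat \<Rightarrow> nat \<Rightarrow> int"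
  assumes "finite J" "inj_on c {..<r}" "c ` {..<r} \<subseteq> J" "\<And>k. k \<in> J \<Longrightarrow> B k \<ge> 1"
    and "\<And>i k. i < r \<Longrightarrow> k \<in> J \<Longrightarrow> \<bar>v i k\<bar> \<le> B k"
  shows "\<bar>minor v c r\<bar> \<le> fact r * (\<Prod>k\<in>J. B k)"
proof -
  let ?A = "mat r r (\<lambda>(i, j). v i (c j))"
  let ?P = "{p. p permutes {0..<r}}"
  have "\<bar>signof p * (\<Prod>i = 0..<r. ?A $$ (i, p i))\<bar> \<le> (\<Prod>k\<in>J. B k)" if p: "p \<in> ?P" for p
  proof -
    have pl: "p i < r" if "i < r" for i using p that permutes_in_image[of p "{0..<r}" i] by auto
    have "\<bar>signof p * (\<Prod>i = 0..<r. ?A $$ (i, p i))\<bar> = (\<Prod>i = 0..<r. \<bar>?A $$ (i, p i)\<bar>)"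
      by (simp add: abs_mult abs_prod sign_def)
    also have "\<dots> \<le> (\<Prod>i = 0..<r. B (c (p i)))"
      using pl assms(3) by (intro prod_mono) (auto intro!: assms(5))
    also have "\<dots> = (\<Prod>i = 0..<r. B (c i))"
      using p prod.permute[of p "{0..<r}" "\<lambda>i. B (c i)"] by (simp add: o_def)
    also have "\<dots> = (\<Prod>k\<in>c ` {..<r}. B k)"
      using assms(2) by (simp add: prod.reindex atLeast0LessThan)
    also have "\<dots> \<le> (\<Prod>k\<in>J. B k)"
      using assms(1,3,4) by (intro prod_mono2) force+
    finally show ?thesis .
  qed
  then have "(\<Sum>p\<in>?P. \<bar>signof p * (\<Prod>i = 0..<r. ?A $$ (i, p i))\<bar>) \<le> of_nat (card ?P) * (\<Prod>k\<in>J. B k)"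
    by (intro sum_bounded_above)
  also have "card ?P = fact r" using card_permutations[of "{0..<r}" r] by simp
  finally show ?thesis
    unfolding minor_def det_def by (auto intro: order_trans[OF sum_abs])
qed

text \<open>Take a nonzero minor of maximal size whose columns avoid \<open>d\<close>. The vector \<open>b\<close> consists of the
  cofactors of the last row when a row from \<open>V\<close> and the column \<open>d\<close> are added. If the enlarged minor did
  not vanish, then by maximality the cofactors of its last column would combine its rows to that minor
  times the \<open>d\<close>-th unit vector.\<close>

lemma small_annihilator:
  fixes a B :: "nat \<Rightarrow> int" and m :: int
  assumes "d \<ge> 1" and dvd: "\<And>v. v \<in> V \<Longrightarrow> m dvd (\<Sum>k=1..d. a k * v k)"
    and bnd: "\<And>v k. v \<in> V \<Longrightarrow> k \<in> {1..d} \<Longrightarrow> \<bar>v k\<bar> \<le> B k"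
    and B1: "\<And>k. k \<in> {1..d} \<Longrightarrow> B k \<ge> 1"
    and cop: "coprime (a d) m" and large: "fact d * (\<Prod>k=1..d. B k) < m"
  shows "\<exists>b. b d \<noteq> 0 \<and> (\<forall>k. \<bar>b k\<bar> \<le> int d * (fact d * (\<Prod>k=1..d. B k)))
    \<and> (\<forall>v\<in>V. (\<Sum>k=1..d. b k * v k) = 0)"
proof -
  define P where "P = (\<Prod>k=1..d. B k)"
  have P1: "P \<ge> 1" unfolding P_def using B1 by (intro prod_ge_1) auto
  define good where "good r \<longleftrightarrow> (\<exists>v c. (\<forall>i<r. v i \<in> V) \<and> c ` {..<r} \<subseteq> {1..<d} \<and> minor v c r \<noteq> 0)"
    for r
  \<comment> \<open>The empty determinant is 1. With the bound \<open>r < d\<close> from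
    \<open>goodle\<close> this yields a largest good \<open>r\<close>.\<close>
  have good0: "good 0" by (auto simp: good_def minor_def)
  have goodle: "r < d" if "good r" for r
  proof -
    obtain v :: "nat \<Rightarrow> nat \<Rightarrow> int" and c where vc: "c ` {..<r} \<subseteq> {1..<d}" "minor v c r \<noteq> 0"
      using \<open>good r\<close> unfolding good_def by blast
    have "card (c ` {..<r}) = r" using inj_on_if_minor_nonzero[OF vc(2)] by (simp add: card_image)
    moreover have "card (c ` {..<r}) \<le> card {1..<d}" by (intro card_mono vc) auto
    ultimately show ?thesis using \<open>d \<ge> 1\<close> by auto
  qed
  obtain r where r: "good r" "\<not> good (Suc r)"
    using good0 goodle by (metis less_irrefl_nat nat_induct)
  have rd: "Suc r \<le> d" using goodle[OF r(1)] by simp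
  obtain v c where vV: "\<And>i. i < r \<Longrightarrow> v i \<in> V" and c: "c ` {..<r} \<subseteq> {1..<d}" and nz: "minor v c r \<noteq> 0"
    using r(1) unfolding good_def by blast
  have cinj: "inj_on c {..<r}" by (rule inj_on_if_minor_nonzero[OF nz])
  define c' where "c' = c(r := d)"
  have c'inj: "inj_on c' {..<Suc r}"
    using cinj c by (auto simp: c'_def lessThan_Suc inj_on_def)
  have c'sub: "c' ` {..<Suc r} \<subseteq> {1..d}"
    using c \<open>d \<ge> 1\<close> by (auto simp: c'_def lessThan_Suc)
  have factle: "fact s * P \<le> fact d * P" if "s \<le> d" for s
    using that P1 by (intro mult_right_mono fact_mono) auto
  have vanish: "minor (v(r := w)) c' (Suc r) = 0" if w: "w \<in> V" for w
  proof (rule ccontr)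
    assume D: "minor (v(r := w)) c' (Suc r) \<noteq> 0"
    define v' where "v' = v(r := w)"
    have v'V: "v' i \<in> V" if "i < Suc r" for i using that vV w by (auto simp: v'_def)
    define h where "h i = (-1) ^ (i + r) * minor (\<lambda>x. v' (if x < i then x else Suc x)) c r" for i
    have ex: "minor v' (c(r := k)) (Suc r) = (\<Sum>i<Suc r. v' i k * h i)" for k
      unfolding h_def by (rule minor_expand_last_col)
    have z: "minor v' (c(r := k)) (Suc r) = 0" if k: "k \<in> {1..<d}" for k
    proof (rule ccontr)
      assume "minor v' (c(r := k)) (Suc r) \<noteq> 0"
      moreover have "(c(r := k)) ` {..<Suc r} \<subseteq> {1..<d}" using c k by (auto simp: lessThan_Suc)
      ultimately have "good (Suc r)" unfolding good_def using v'V by blast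
      with r(2) show False ..
    qed
    \<comment> \<open>The coordinates of the combined row are bordered minors. Those with
      \<open>k < d\<close> vanish by \<open>z\<close>, so orthogonality to \<open>a\<close> leaves
      only \<open>a d\<close> times the minor with column \<open>d\<close>.\<close>
    have "(\<Sum>i<Suc r. h i * (\<Sum>k=1..d. a k * v' i k)) = (\<Sum>k=1..d. a k * (\<Sum>i<Suc r. v' i k * h i))"
      unfolding sum_distrib_left by (subst sum.swap) (simp add: algebra_simps)
    also have "\<dots> = (\<Sum>k=1..d. a k * minor v' (c(r := k)) (Suc r))" by (simp only: ex)
    also have "\<dots> = (\<Sum>k\<in>{d}. a k * minor v' (c(r := k)) (Suc r))"
      using z \<open>d \<ge> 1\<close> by (intro sum.mono_neutral_right) auto
    finally have "(\<Sum>i<Suc r. h i * (\<Sum>k=1..d. a k * v' i k)) = a d * minor v' c' (Suc r)"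
      by (simp add: c'_def)
    moreover have "m dvd (\<Sum>i<Suc r. h i * (\<Sum>k=1..d. a k * v' i k))"
      by (rule dvd_sum, rule dvd_mult, rule dvd) (auto intro: v'V)
    ultimately have "m dvd minor v' c' (Suc r)"
      using cop by (simp add: coprime_commute coprime_dvd_mult_right_iff)
    then have "m \<le> \<bar>minor v' c' (Suc r)\<bar>"
      using D dvd_imp_le_int[of "minor v' c' (Suc r)" m] by (simp add: v'_def)
    also have "\<dots> \<le> fact (Suc r) * P"
      unfolding P_def using c'inj c'sub B1 bnd v'V by (intro minor_bound) auto
    also have "\<dots> \<le> fact d * P" by (rule factle[OF rd])
    finally show False using large by (simp add: P_def)
  qed
  define h where "h j = (-1) ^ (r + j) * minor v (\<lambda>x. c' (if x < j then x else Suc x)) r" for j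
  have hr: "h r = minor v c r"
    unfolding h_def using minor_cong[of r v v "\<lambda>x. c' (if x < r then x else Suc x)" c]
    by (auto simp: c'_def simp flip: mult_2)
  have habs: "\<bar>h j\<bar> \<le> fact d * P" if "j < Suc r" for j
  proof -
    have "\<bar>h j\<bar> = \<bar>minor v (\<lambda>x. c' (if x < j then x else Suc x)) r\<bar>"
      by (simp add: h_def abs_mult power_abs)
    also have "\<dots> \<le> fact r * P"
      unfolding P_def
    proof (rule minor_bound)
      show "inj_on (\<lambda>x. c' (if x < j then x else Suc x)) {..<r}"
        by (rule inj_onI, drule inj_onD[OF c'inj]) (auto split: if_splits)
      show "(\<lambda>x. c' (if x < j then x else Suc x)) ` {..<r} \<subseteq> {1..d}"
        using c'sub by (auto simp: image_subset_iff)
    qed (use B1 bnd vV in auto)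
    also have "\<dots> \<le> fact d * P" using rd by (intro factle) auto
    finally show ?thesis .
  qed
  \<comment> \<open>As \<open>c'\<close> is injective, the sum has at most one term: the cofactor of
    column \<open>k\<close> if that column occurs, and 0 otherwise. Column \<open>d\<close> occurs
    only at position \<open>r\<close>, which gives \<open>b d = h r\<close>.\<close>
  define b where "b k = (\<Sum>j\<in>{j. j < Suc r \<and> c' j = k}. h j)" for k
  show ?thesis
  proof (intro exI[of _ b] conjI allI ballI)
    have "{j. j < Suc r \<and> c' j = d} = {r}" using c by (auto simp: c'_def less_Suc_eq)
    then show "b d \<noteq> 0" using nz hr by (simp add: b_def)
    fix k
    have "\<bar>b k\<bar> \<le> (\<Sum>j\<in>{j. j < Suc r \<and> c' j = k}. \<bar>h j\<bar>)" unfolding b_def by (rule sum_abs)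
    also have "\<dots> \<le> (\<Sum>j<Suc r. \<bar>h j\<bar>)" by (intro sum_mono2) auto
    also have "\<dots> \<le> int (card {..<Suc r}) * (fact d * P)"
      using sum_bounded_above[of "{..<Suc r}" "\<lambda>j. \<bar>h j\<bar>" "fact d * P"] habs by simp
    also have "\<dots> \<le> int d * (fact d * P)" using rd P1 by (intro mult_right_mono) auto
    finally show "\<bar>b k\<bar> \<le> int d * (fact d * (\<Prod>k=1..d. B k))" by (simp add: P_def)
  next
    fix w assume w: "w \<in> V"
    have "(\<Sum>k=1..d. b k * w k) = (\<Sum>k=1..d. \<Sum>j\<in>{j. j \<in> {..<Suc r} \<and> c' j = k}. w (c' j) * h j)"
      unfolding b_def sum_distrib_right by (intro sum.cong) (auto simp: mult.commute)
    also have "\<dots> = (\<Sum>j<Suc r. w (c' j) * h j)"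
      by (rule sum.group) (use c'sub in auto)
    also have "\<dots> = minor (v(r := w)) c' (Suc r)"
      unfolding h_def by (rule minor_expand_last_row[symmetric])
    finally show "(\<Sum>k=1..d. b k * w k) = 0" using vanish[OF w] by simp
  qed
qed

subsection \<open>Energy of integer polynomials\<close>

text \<open>If \<open>g (y + e) - g y\<close> were constant, \<open>g\<close> would be linear on the
  multiples of \<open>e\<close>, contradicting degree at least 2. Hence the difference polynomial is
  nonzero and has at most \<open>degree g\<close> roots.\<close>

lemma card_shift_difference_roots:
  fixes g :: "int poly"
  assumes deg: "degree g \<ge> 2" and e: "e \<noteq> 0"
  shows "finite {y. poly g (y + e) - poly g y = n}" (is "finite ?Y")
    and "card {y. poly g (y + e) - poly g y = n} \<le> degree g"
proof -
  define h where "h = pcompose g [:e, 1:] - g - [:n:]"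
  have ph: "poly h y = poly g (y + e) - poly g y - n" for y
    by (simp add: h_def poly_pcompose add.commute)
  have "h \<noteq> 0"
  proof
    assume "h = 0"
    then have step: "poly g (y + e) = poly g y + n" for y using ph[of y] by simp
    have lin: "poly g (int k * e) = poly g 0 + int k * n" for k
    proof (induction k)
      case (Suc k)
      then show ?case using step[of "int k * e"] by (simp add: algebra_simps)
    qed simp
    define q where "q = pcompose g [:0, e:] - [:poly g 0, n:]"
    have "range int \<subseteq> {x. poly q x = 0}"
      using lin by (auto simp: q_def poly_pcompose mult.commute)
    moreover have "infinite (range int)" by (simp add: finite_image_iff)
    ultimately have "q = 0" using poly_roots_finite finite_subset by blast
    then have "pcompose g [:0, e:] = [:poly g 0, n:]" by (simp add: q_def)
    moreover have "degree (pcompose g [:0, e:]) = degree g" using e by (simp add: degree_pcompose)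
    moreover have "degree [:poly g 0, n:] \<le> 1" by simp
    ultimately show False using deg by simp
  qed
  have Y: "?Y = {y. poly h y = 0}" by (auto simp: ph)
  have "degree h \<le> degree g"
    unfolding h_def by (intro degree_diff_le) (auto simp: degree_pcompose)
  then show "finite ?Y" "card ?Y \<le> degree g"
    using card_poly_roots_bound[OF \<open>h \<noteq> 0\<close>] poly_roots_finite[OF \<open>h \<noteq> 0\<close>] by (auto simp: Y)
qed

lemma diff_dvd_poly_diff:
  fixes p :: "'a::comm_ring_1 poly"
  shows "x - y dvd poly p x - poly p y"
proof -
  have "poly (p - [:poly p y:]) y = 0" by simp
  then obtain q where "p - [:poly p y:] = [:-y, 1:] * q"
    unfolding poly_eq_0_iff_dvd by (elim dvdE)
  then have "poly (p - [:poly p y:]) x = poly ([:-y, 1:] * q) x" by simp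
  then have "poly p x - poly p y = (x - y) * poly q x" by (simp add: algebra_simps)
  then show ?thesis by simp
qed

lemma card_int_divisors_le:
  fixes n :: int
  assumes "n \<noteq> 0"
  shows "finite {e. e dvd n}" and "card {e. e dvd n} \<le> 2 * card {e::nat. e dvd nat \<bar>n\<bar>}"
proof -
  let ?D = "{e::nat. e dvd nat \<bar>n\<bar>}"
  show "finite {e. e dvd n}" using assms by simp
  have fin: "finite ?D" using assms by (intro finite_divisors_nat) simp
  have "{e. e dvd n} \<subseteq> int ` ?D \<union> (\<lambda>e. - int e) ` ?D"
  proof
    fix e assume "e \<in> {e. e dvd n}"
    then have "nat \<bar>e\<bar> \<in> ?D" by (simp add: nat_dvd_iff)
    moreover have "e = int (nat \<bar>e\<bar>) \<or> e = - int (nat \<bar>e\<bar>)" by auto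
    ultimately show "e \<in> int ` ?D \<union> (\<lambda>e. - int e) ` ?D" by blast
  qed
  then have "card {e. e dvd n} \<le> card (int ` ?D \<union> (\<lambda>e. - int e) ` ?D)"
    using fin by (intro card_mono) auto
  also have "\<dots> \<le> card (int ` ?D) + card ((\<lambda>e. - int e) ` ?D)" by (rule card_Un_le)
  also have "\<dots> \<le> 2 * card ?D"
    using card_image_le[OF fin, of int] card_image_le[OF fin, of "\<lambda>e. - int e"] by linarith
  finally show "card {e. e dvd n} \<le> 2 * card ?D" .
qed

text \<open>If \<open>n = poly g x - poly g z\<close> is nonzero, then \<open>w - y\<close> divides \<open>n\<close>, and each divisor
  leaves at most \<open>degree g\<close> choices of \<open>y\<close>.\<close>

lemma card_int_energy_le:
  fixes g :: "int poly" and N D :: nat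
  assumes deg: "degree g \<ge> 2"
    and D: "\<And>x z. x \<in> {1..int N} \<Longrightarrow> z \<in> {1..int N} \<Longrightarrow> poly g x \<noteq> poly g z \<Longrightarrow>
      card {e::nat. e dvd nat \<bar>poly g x - poly g z\<bar>} \<le> D"
  shows "card {(x, y, z, w). x \<in> {1..int N} \<and> y \<in> {1..int N} \<and> z \<in> {1..int N} \<and> w \<in> {1..int N} \<and>
      poly g x + poly g y = poly g z + poly g w} \<le> N ^ 2 * (degree g ^ 2 + 2 * D * degree g)" (is "card ?S \<le> _")
proof -
  let ?I = "{1..int N}" and ?d = "degree g"
  define R where "R x = {z. poly g z = poly g x}" for x
  have Rfin: "finite (R x)" and Rcard: "card (R x) \<le> ?d" for x
  proof -
    let ?h = "g - [:poly g x:]"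
    have dh: "degree ?h \<le> ?d" by (intro degree_diff_le) auto
    have "?h \<noteq> 0"
    proof
      assume "?h = 0"
      then have "degree g = degree [:poly g x:]" by simp
      then show False using deg by simp
    qed
    moreover have "R x = {z. poly ?h z = 0}" by (auto simp: R_def)
    ultimately show "finite (R x)" "card (R x) \<le> ?d"
      using card_poly_roots_bound[of ?h] poly_roots_finite[of ?h] dh by (auto intro: order_trans)
  qed
  \<comment> \<open>\<open>F\<close> collects the solutions with \<open>g x = g z\<close>, hence
    \<open>g y = g w\<close>: given \<open>(x, y)\<close>, both \<open>z\<close> and
    \<open>w\<close> lie in fibres of \<open>g\<close>.\<close>
  define F where "F = (\<lambda>(x, y). (\<lambda>(z, w). (x, y, z, w)) ` (R x \<times> R y))"
  define L where "L x z e = (\<lambda>y. (x, y, z, y + e)) ` {y. poly g (y + e) - poly g y = poly g x - poly g z}"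
    for x z e
  \<comment> \<open>\<open>G\<close> collects the others, with \<open>e = w - y\<close>. The
    diagonal is sent to the empty set because every integer divides 0.\<close>
  define G where "G = (\<lambda>(x, z). if poly g x = poly g z then {}
    else (\<Union>e\<in>{e. e dvd poly g x - poly g z}. L x z e))"
  have "?S \<subseteq> (\<Union>t\<in>?I \<times> ?I. F t) \<union> (\<Union>t\<in>?I \<times> ?I. G t)"
  proof clarify
    fix x y z w assume I: "x \<in> ?I" "y \<in> ?I" "z \<in> ?I" "w \<in> ?I"
      and eq: "poly g x + poly g y = poly g z + poly g w"
      and nG: "(x, y, z, w) \<notin> (\<Union>t\<in>?I \<times> ?I. G t)"
    have "poly g x = poly g z"
    proof (rule ccontr)
      assume ne: "poly g x \<noteq> poly g z"
      have eq': "poly g w - poly g y = poly g x - poly g z" using eq by simp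
      have "w - y dvd poly g x - poly g z" using diff_dvd_poly_diff[of w y g] eq' by simp
      moreover have "(x, y, z, w) \<in> L x z (w - y)"
        unfolding L_def using eq' by (intro image_eqI[of _ _ y]) auto
      ultimately have "(x, y, z, w) \<in> G (x, z)" using ne by (auto simp: G_def)
      then show False using nG I by blast
    qed
    then have "(x, y, z, w) \<in> F (x, y)" using eq by (auto simp: F_def R_def)
    then show "(x, y, z, w) \<in> (\<Union>t\<in>?I \<times> ?I. F t)" using I by blast
  qed
  moreover have Ffin: "finite (F t)" and Fcard: "card (F t) \<le> ?d ^ 2" for t
  proof -
    obtain x y where t: "t = (x, y)" by (cases t)
    show "finite (F t)" using Rfin by (simp add: F_def t)
    have "card (F t) \<le> card (R x \<times> R y)"
      unfolding F_def t prod.case using Rfin by (intro card_image_le) simp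
    also have "\<dots> \<le> ?d ^ 2"
      using mult_le_mono[OF Rcard Rcard] by (simp add: card_cartesian_product power2_eq_square)
    finally show "card (F t) \<le> ?d ^ 2" .
  qed
  moreover have Gfin: "finite (G t)" and Gcard: "card (G t) \<le> 2 * D * ?d" if "t \<in> ?I \<times> ?I" for t
  proof -
    obtain x z where t: "t = (x, z)" by (cases t)
    have "finite (G t) \<and> card (G t) \<le> 2 * D * ?d"
    proof (cases "poly g x = poly g z")
      case False
      let ?n = "poly g x - poly g z"
      let ?E = "{e. e dvd ?n}"
      have n: "?n \<noteq> 0" using False by simp
      have Gt: "G t = (\<Union>e\<in>?E. L x z e)" using False by (simp add: G_def t)
      have L: "finite (L x z e)" "card (L x z e) \<le> ?d" if "e \<in> ?E" for e
      proof -
        have e: "e \<noteq> 0" using that n by auto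
        show "finite (L x z e)" unfolding L_def
          by (intro finite_imageI card_shift_difference_roots(1) deg e)
        show "card (L x z e) \<le> ?d" unfolding L_def
          using card_image_le[OF card_shift_difference_roots(1)[OF deg e]]
            card_shift_difference_roots(2)[OF deg e] by (rule order_trans)
      qed
      have Efin: "finite ?E" by (rule card_int_divisors_le[OF n])
      have "card (G t) \<le> (\<Sum>e\<in>?E. card (L x z e))"
        unfolding Gt by (rule card_UN_le[OF Efin])
      also have "\<dots> \<le> (\<Sum>e\<in>?E. ?d)" by (intro sum_mono L)
      also have "\<dots> = card ?E * ?d" by simp
      also have "\<dots> \<le> (2 * D) * ?d"
        using card_int_divisors_le(2)[OF n] D[of x z] that False t by (intro mult_le_mono1) auto
      finally show ?thesis using Gt Efin L by auto
    qed (simp add: G_def t)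
    then show "finite (G t)" "card (G t) \<le> 2 * D * ?d" by auto
  qed
  ultimately have "card ?S \<le> card ((\<Union>t\<in>?I \<times> ?I. F t) \<union> (\<Union>t\<in>?I \<times> ?I. G t))"
    by (intro card_mono finite_UnI finite_UN_I) auto
  also have "\<dots> \<le> card (\<Union>t\<in>?I \<times> ?I. F t) + card (\<Union>t\<in>?I \<times> ?I. G t)" by (rule card_Un_le)
  also have "\<dots> \<le> (\<Sum>t\<in>?I \<times> ?I. card (F t)) + (\<Sum>t\<in>?I \<times> ?I. card (G t))"
    by (intro add_mono card_UN_le) auto
  also have "\<dots> \<le> (\<Sum>t\<in>?I \<times> ?I. ?d ^ 2) + (\<Sum>t\<in>?I \<times> ?I. 2 * D * ?d)"
    by (intro add_mono sum_mono Fcard Gcard)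
  also have "\<dots> = N ^ 2 * (?d ^ 2 + 2 * D * ?d)"
    by (simp add: card_cartesian_product power2_eq_square algebra_simps)
  finally show "card ?S \<le> N ^ 2 * (?d ^ 2 + 2 * D * ?d)" .
qed

subsection \<open>Short intervals\<close>

lemma prod_two_mult_power: "(\<Prod>k=1..d. 2 * (x::'a::comm_semiring_1) ^ k) = 2 ^ d * x ^ (\<Sum>k=1..d. k)"
  by (simp add: prod.distrib power_sum)

text \<open>\<open>small_annihilator\<close> is applied to the power-sum vectors with
  \<open>B k = 2 * N ^ k\<close>. The resulting \<open>g\<close> depends on \<open>m\<close> and
  \<open>f\<close>, but its values on the interval are bounded in terms of \<open>d\<close> and
  \<open>N\<close> alone, as the divisor bound requires.\<close>

lemma T_count_le_int_energy:
  fixes f :: "int poly" and N m d :: nat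
  assumes d: "d \<ge> 2" and f: "degree f = d" "coprime (coeff f d) (int m)" and N: "N \<ge> 1"
    and small: "fact d * 2 ^ d * N ^ (\<Sum>k=1..d. k) < m"
  shows "\<exists>g::int poly. degree g = d
    \<and> (\<forall>x\<in>{1..int N}. \<forall>z\<in>{1..int N}.
        \<bar>poly g x - poly g z\<bar> \<le> int (d ^ 2 * fact d * 2 ^ d * N ^ ((\<Sum>k=1..d. k) + d)))
    \<and> T_count f m {1..int N} \<le> card {(x, y, z, w). x \<in> {1..int N} \<and> y \<in> {1..int N} \<and>
        z \<in> {1..int N} \<and> w \<in> {1..int N} \<and> poly g x + poly g y = poly g z + poly g w}"
proof -
  let ?I = "{1..int N}" and ?s = "\<Sum>k=1..d. k"
  let ?cong = "\<lambda>x y z w. [poly f x + poly f y = poly f z + poly f w] (mod int m)"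
  define v where "v = (\<lambda>(x, y, z, w) k. x ^ k + y ^ k - z ^ k - w ^ k :: int)"
  define V where "V = v ` {(x, y, z, w). x \<in> ?I \<and> y \<in> ?I \<and> z \<in> ?I \<and> w \<in> ?I \<and> ?cong x y z w}"
  define B where "B k = 2 * int N ^ k" for k
  have PB: "(\<Prod>k=1..d. B k) = 2 ^ d * int N ^ ?s"
    unfolding B_def by (rule prod_two_mult_power)
  have "\<exists>b. b d \<noteq> 0 \<and> (\<forall>k. \<bar>b k\<bar> \<le> int d * (fact d * (\<Prod>k=1..d. B k)))
    \<and> (\<forall>v\<in>V. (\<Sum>k=1..d. b k * v k) = 0)"
  proof (rule small_annihilator)
    show "1 \<le> d" using d by simp
    show "coprime (coeff f d) (int m)" by (rule f)
    have "int (fact d * 2 ^ d * N ^ ?s) < int m" using small by (simp only: of_nat_less_iff)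
    then show "fact d * (\<Prod>k=1..d. B k) < int m" unfolding PB by (simp add: mult.assoc)
    show "1 \<le> B k" for k using N one_le_power[of "int N" k] unfolding B_def by linarith
    fix u assume "u \<in> V"
    then obtain x y z w where u: "u = v (x, y, z, w)" and I: "x \<in> ?I" "y \<in> ?I" "z \<in> ?I" "w \<in> ?I"
      and c: "?cong x y z w" unfolding V_def by auto
    have "int m dvd poly f x + poly f y - (poly f z + poly f w)"
      using c by (simp add: cong_iff_dvd_diff)
    also have "poly f x + poly f y - (poly f z + poly f w) = (\<Sum>k\<le>d. coeff f k * u k)"
      by (simp add: poly_altdef f(1) u v_def sum.distrib sum_subtractf algebra_simps)
    \<comment> \<open>The constant coefficient drops out because
      \<open>u 0 = 1 + 1 - 1 - 1 = 0\<close>.\<close>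
    also have "\<dots> = (\<Sum>k=1..d. coeff f k * u k)"
      by (intro sum.mono_neutral_right) (auto simp: u v_def not_less_eq_eq)
    finally show "int m dvd (\<Sum>k=1..d. coeff f k * u k)" .
    fix k
    have pw: "0 \<le> t ^ k \<and> t ^ k \<le> int N ^ k" if "t \<in> ?I" for t
      using that by (auto intro!: power_mono)
    show "\<bar>u k\<bar> \<le> B k"
      using pw[OF I(1)] pw[OF I(2)] pw[OF I(3)] pw[OF I(4)] by (simp add: u v_def B_def) linarith
  qed
  then obtain b where b: "b d \<noteq> 0" "\<And>k. \<bar>b k\<bar> \<le> int d * (fact d * (2 ^ d * int N ^ ?s))"
    "\<And>u. u \<in> V \<Longrightarrow> (\<Sum>k=1..d. b k * u k) = 0" unfolding PB by blast
  define g where "g = (\<Sum>k=1..d. monom (b k) k)"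
  have cg: "coeff g j = (if j \<in> {1..d} then b j else 0)" for j
    by (simp add: g_def coeff_sum)
  have pg: "poly g x = (\<Sum>k=1..d. b k * x ^ k)" for x
    by (simp add: g_def poly_sum poly_monom)
  have deg: "degree g = d"
  proof (rule antisym)
    show "degree g \<le> d" by (rule degree_le) (auto simp: cg)
    show "d \<le> degree g" by (rule le_degree) (use b d in \<open>auto simp: cg\<close>)
  qed
  have bound: "\<bar>poly g x - poly g z\<bar> \<le> int (d ^ 2 * fact d * 2 ^ d * N ^ (?s + d))"
    if x: "x \<in> ?I" "z \<in> ?I" for x z
  proof -
    have "\<bar>b k * (x ^ k - z ^ k)\<bar> \<le> (int d * (fact d * (2 ^ d * int N ^ ?s))) * int N ^ d"
      if k: "k \<in> {1..d}" for k
      unfolding abs_mult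
    proof (intro mult_mono b(2))
      have "0 \<le> t ^ k \<and> t ^ k \<le> int N ^ k" if "t \<in> ?I" for t
        using that by (auto intro!: power_mono)
      moreover have "int N ^ k \<le> int N ^ d" using k N by (intro power_increasing) auto
      ultimately show "\<bar>x ^ k - z ^ k\<bar> \<le> int N ^ d" using x by (smt (verit))
    qed auto
    then have sum_bound: "(\<Sum>k=1..d. \<bar>b k * (x ^ k - z ^ k)\<bar>)
        \<le> int (card {1..d}) * ((int d * (fact d * (2 ^ d * int N ^ ?s))) * int N ^ d)"
      by (intro sum_bounded_above)
    have "\<bar>poly g x - poly g z\<bar> = \<bar>\<Sum>k=1..d. b k * (x ^ k - z ^ k)\<bar>"
      by (simp add: pg sum_subtractf right_diff_distrib)
    also have "\<dots> \<le> (\<Sum>k=1..d. \<bar>b k * (x ^ k - z ^ k)\<bar>)" by (rule sum_abs)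
    also note sum_bound
    also have "int (card {1..d}) * ((int d * (fact d * (2 ^ d * int N ^ ?s))) * int N ^ d)
        = int (d ^ 2 * fact d * 2 ^ d * N ^ (?s + d))"
      by (simp add: power_add power2_eq_square mult_ac)
    finally show ?thesis .
  qed
  have "T_count f m ?I \<le> card {(x, y, z, w). x \<in> ?I \<and> y \<in> ?I \<and> z \<in> ?I \<and> w \<in> ?I \<and>
      poly g x + poly g y = poly g z + poly g w}"
    unfolding T_count_def
  proof (rule card_mono)
    show "finite {(x, y, z, w). x \<in> ?I \<and> y \<in> ?I \<and> z \<in> ?I \<and> w \<in> ?I \<and>
      poly g x + poly g y = poly g z + poly g w}"
      by (rule finite_subset[of _ "?I \<times> ?I \<times> ?I \<times> ?I"]) auto
    have "poly g x + poly g y = poly g z + poly g w"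
      if "x \<in> ?I" "y \<in> ?I" "z \<in> ?I" "w \<in> ?I" "?cong x y z w" for x y z w
    proof -
      have "v (x, y, z, w) \<in> V" using that unfolding V_def by blast
      from b(3)[OF this] show ?thesis
        by (simp add: v_def pg sum.distrib sum_subtractf algebra_simps)
    qed
    then show "{(x, y, z, w). x \<in> ?I \<and> y \<in> ?I \<and> z \<in> ?I \<and> w \<in> ?I \<and> ?cong x y z w}
      \<subseteq> {(x, y, z, w). x \<in> ?I \<and> y \<in> ?I \<and> z \<in> ?I \<and> w \<in> ?I \<and>
        poly g x + poly g y = poly g z + poly g w}" by blast
  qed
  then show ?thesis using deg bound by blast
qed

lemma T_count_short:
  fixes d :: nat and \<epsilon> :: real
  assumes d: "d \<ge> 2" and \<epsilon>: "\<epsilon> > 0"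
  shows "\<exists>C\<ge>1. \<forall>(m::nat) (f::int poly) (N::nat). degree f = d \<longrightarrow> coprime (coeff f d) (int m) \<longrightarrow> N \<ge> 1
    \<longrightarrow> fact d * 2 ^ d * N ^ (\<Sum>k=1..d. k) < m
    \<longrightarrow> real (T_count f m {1..int N}) \<le> C * real N ^ 2 * real N powr \<epsilon>"
proof -
  define s where "s = (\<Sum>k=1..d. k)"
  \<comment> \<open>The differences of values of \<open>g\<close> are at most a constant times
    \<open>N ^ (s + d)\<close>, whose \<open>\<delta>\<close>-th power contributes exactly
    \<open>N powr \<epsilon>\<close>.\<close>
  define \<delta> where "\<delta> = \<epsilon> / real (s + d)"
  have \<delta>: "\<delta> > 0" "real (s + d) * \<delta> = \<epsilon>" using d \<epsilon> by (auto simp: \<delta>_def)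
  obtain C\<^sub>1 where C1: "C\<^sub>1 > 0" "\<And>n. n > 0 \<Longrightarrow> real (card {e::nat. e dvd n}) \<le> C\<^sub>1 * real n powr \<delta>"
    using card_divisors_powr_bound[OF \<delta>(1)] by blast
  define K :: real where "K = real (d ^ 2 * fact d * 2 ^ d)"
  define C\<^sub>2 where "C\<^sub>2 = C\<^sub>1 * K powr \<delta>"
  have C2: "C\<^sub>2 \<ge> 0" using C1 by (simp add: C\<^sub>2_def)
  define C where "C = real d ^ 2 + 2 * C\<^sub>2 * real d"
  have "real (T_count f m {1..int N}) \<le> C * real N ^ 2 * real N powr \<epsilon>"
    if f: "degree f = d" "coprime (coeff f d) (int m)" and N: "N \<ge> 1"
      and small: "fact d * 2 ^ d * N ^ (\<Sum>k=1..d. k) < m" for m f N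
  proof -
    let ?I = "{1..int N}"
    obtain g :: "int poly" where g: "degree g = d"
      "\<And>x z. x \<in> ?I \<Longrightarrow> z \<in> ?I \<Longrightarrow> \<bar>poly g x - poly g z\<bar> \<le> int (d ^ 2 * fact d * 2 ^ d * N ^ (s + d))"
      "T_count f m ?I \<le> card {(x, y, z, w). x \<in> ?I \<and> y \<in> ?I \<and> z \<in> ?I \<and> w \<in> ?I \<and>
          poly g x + poly g y = poly g z + poly g w}"
      using T_count_le_int_energy[OF d f N small] unfolding s_def by blast
    define D where "D = nat \<lfloor>C\<^sub>2 * real N powr \<epsilon>\<rfloor>"
    have D: "real D \<le> C\<^sub>2 * real N powr \<epsilon>" unfolding D_def using C2 by (intro of_nat_floor) auto
    have "card {e::nat. e dvd nat \<bar>poly g x - poly g z\<bar>} \<le> D"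
      if "x \<in> ?I" "z \<in> ?I" "poly g x \<noteq> poly g z" for x z
      unfolding D_def
    proof (rule le_nat_floor)
      let ?n = "nat \<bar>poly g x - poly g z\<bar>"
      have "?n \<le> d ^ 2 * fact d * 2 ^ d * N ^ (s + d)" using g(2)[OF that(1,2)] by linarith
      then have "real ?n \<le> real (d ^ 2 * fact d * 2 ^ d * N ^ (s + d))" by (simp only: of_nat_le_iff)
      also have "\<dots> = K * real N ^ (s + d)" by (simp add: K_def)
      finally have "real ?n powr \<delta> \<le> (K * real N ^ (s + d)) powr \<delta>"
        using \<delta>(1) by (intro powr_mono2) auto
      also have "\<dots> = K powr \<delta> * real N powr \<epsilon>"
        using N \<delta>(2) by (simp add: powr_mult K_def powr_realpow[symmetric] powr_powr)
      finally have "C\<^sub>1 * real ?n powr \<delta> \<le> C\<^sub>2 * real N powr \<epsilon>"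
        using C1(1) by (simp add: C\<^sub>2_def)
      moreover have "?n > 0" using that(3) by simp
      ultimately show "real (card {e. e dvd ?n}) \<le> C\<^sub>2 * real N powr \<epsilon>"
        using C1(2)[of ?n] by linarith
    qed
    then have "T_count f m ?I \<le> N ^ 2 * (d ^ 2 + 2 * D * d)"
      using card_int_energy_le[of g N D] g d by (meson order_trans)
    then have "real (T_count f m ?I) \<le> real (N ^ 2 * (d ^ 2 + 2 * D * d))" by (simp only: of_nat_le_iff)
    also have "\<dots> = real N ^ 2 * (real d ^ 2 * 1 + 2 * real D * real d)" by simp
    also have "\<dots> \<le> real N ^ 2 * (real d ^ 2 * real N powr \<epsilon> + 2 * (C\<^sub>2 * real N powr \<epsilon>) * real d)"
      using D N \<epsilon> by (intro mult_left_mono add_mono mult_right_mono ge_one_powr_ge_zero) auto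
    also have "\<dots> = C * real N ^ 2 * real N powr \<epsilon>" by (simp add: C_def algebra_simps)
    finally show ?thesis .
  qed
  moreover have "C \<ge> 1"
  proof -
    have "1 \<le> real d ^ 2" using d by (intro one_le_power) auto
    moreover have "0 \<le> 2 * C\<^sub>2 * real d" using C2 by simp
    ultimately show ?thesis by (simp add: C_def)
  qed
  ultimately show ?thesis by blast
qed

subsection \<open>Arbitrary intervals\<close>

text \<open>The factor with exponent \<open>o(1)\<close> is expressed by the order of quantifiers:
  \<open>C\<close> is chosen after \<open>d\<close> and \<open>\<epsilon>\<close> but before
  \<open>m\<close>, \<open>f\<close> and \<open>H\<close>.\<close>

theorem theorem1p3:
  fixes d :: nat and \<epsilon> :: real
  assumes "d \<ge> 2" and "\<epsilon> > 0"
  shows "\<exists>C::real. \<forall>(m::nat) (f::int poly) (H::nat).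
           m \<ge> 2 \<longrightarrow> degree f = d \<longrightarrow> coprime (coeff f d) (int m) \<longrightarrow> 1 \<le> H \<longrightarrow> H \<le> m \<longrightarrow>
           real (T_count f m {1..int H})
             \<le> (real H ^ 4 / real m powr (4 / (real d * (real d + 1))) + real H ^ 2)
                 * (C * real H powr \<epsilon>)"
proof -
  obtain C where C: "C \<ge> 1"
    and short: "\<And>(m::nat) (f::int poly) (N::nat). degree f = d \<Longrightarrow> coprime (coeff f d) (int m) \<Longrightarrow>
      N \<ge> 1 \<Longrightarrow> fact d * 2 ^ d * N ^ (\<Sum>k=1..d. k) < m \<Longrightarrow>
      real (T_count f m {1..int N}) \<le> C * real N ^ 2 * real N powr \<epsilon>"
    using T_count_short[OF assms] by blast
  define s where "s = (\<Sum>k=1..d. k)"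
  define \<theta> where "\<theta> = 2 / (real d * (real d + 1))"
  have "2 * s = d * (d + 1)" unfolding s_def by (induction d) auto
  then have "2 * real s = real d * (real d + 1)"
    by (metis of_nat_mult of_nat_add of_nat_1 of_nat_numeral)
  moreover have "real d * (real d + 1) > 0" using assms(1) by simp
  ultimately have s\<theta>: "real s * \<theta> = 1" and \<theta>: "\<theta> > 0" by (auto simp: \<theta>_def field_simps)
  \<comment> \<open>The factor 2 turns \<open>n \<le> R\<close> into
    \<open>fact d * 2 ^ d * n ^ s \<le> m / 2\<close>, which gives the strict inequality demanded
    for short intervals.\<close>
  define c :: real where "c = 2 * (fact d * 2 ^ d)"
  have c: "c > 0" by (simp add: c_def)
  \<comment> \<open>64 is \<open>2 ^ 4 * 2 ^ 2\<close>, from \<open>k * N \<le> 2 * H\<close> and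
    \<open>N \<ge> R / 2\<close>; the power of \<open>c\<close> comes from \<open>R ^ 2\<close>. The
    summand \<open>C\<close> serves the case \<open>H \<le> N\<close>.\<close>
  define C' where "C' = 64 * C * c powr (2 * \<theta>) + C"
  have "real (T_count f m {1..int H})
             \<le> (real H ^ 4 / real m powr (2 * \<theta>) + real H ^ 2) * (C' * real H powr \<epsilon>)"
    if m: "m \<ge> 2" and f: "degree f = d" "coprime (coeff f d) (int m)" and H: "1 \<le> H"
    for m f H
  proof -
    define R where "R = (real m / c) powr \<theta>"
    \<comment> \<open>\<open>N\<close> is the critical block length. For \<open>m < c\<close> the
      floor is 0 and \<open>N = 1\<close>; a block of one point has a single solution, so
      \<open>block\<close> treats \<open>n = 1\<close> separately.\<close>
    define N where "N = max 1 (nat \<lfloor>R\<rfloor>)"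
    have R0: "R > 0" using m c by (simp add: R_def)
    have N1: "N \<ge> 1" by (simp add: N_def)
    have RN: "R \<le> 2 * real N" unfolding N_def by linarith
    have block: "real (T_count f' m {1..int n}) \<le> C * real n ^ 2 * real n powr \<epsilon>"
      if f': "degree f' = d" "coprime (coeff f' d) (int m)" and n: "n \<ge> 1" "n \<le> N" for f' n
    proof (cases "n = 1")
      case True
      have "T_count f' m {1..int n} \<le> card {(1::int, 1::int, 1::int, 1::int)}"
        unfolding T_count_def using True by (intro card_mono) auto
      then show ?thesis using True C by simp
    next
      case False
      then have "real n \<le> R" using n R0 unfolding N_def by linarith
      then have "real n ^ s \<le> R ^ s" by (intro power_mono) auto
      also have "\<dots> = real m / c"
        using R0 s\<theta> m c by (simp add: R_def powr_realpow[symmetric] powr_powr mult.commute)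
      finally have "fact d * 2 ^ d * real n ^ s \<le> real m / 2"
        using c by (simp add: c_def field_simps)
      also have "\<dots> < real m" using m by simp
      finally have "real (fact d * 2 ^ d * n ^ s) < real m" by simp
      then have "fact d * 2 ^ d * n ^ s < m" by (simp only: of_nat_less_iff)
      then show ?thesis using short[OF f' n(1)] by (simp add: s_def)
    qed
    have Hm: "0 \<le> real H ^ 4 / real m powr (2 * \<theta>)" by simp
    show ?thesis
    proof (cases "H \<le> N")
      case True
      have "real (T_count f m {1..int H}) \<le> real H ^ 2 * (C * real H powr \<epsilon>)"
        using block[OF f H True] by (simp add: mult_ac)
      also have "\<dots> \<le> (real H ^ 4 / real m powr (2 * \<theta>) + real H ^ 2) * (C' * real H powr \<epsilon>)"
        using Hm C c by (intro mult_mono mult_right_mono) (auto simp: C'_def)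
      finally show ?thesis .
    next
      case False
      \<comment> \<open>The last block may extend past \<open>H\<close>, which is harmless for a
        cover. Since \<open>N < H\<close>, the total length \<open>k * N\<close> is at most
        \<open>H + N\<close>, hence at most \<open>2 * H\<close>.\<close>
      define k where "k = H div N + 1"
      define J where "J i = {int (i * N) + 1..int (i * N) + int N}" for i
      define M where "M = nat \<lfloor>C * real N ^ 2 * real N powr \<epsilon>\<rfloor>"
      have kN: "real k * real N \<le> 2 * real H"
      proof -
        have "k * N \<le> 2 * H" using False div_times_less_eq_dividend[of H N] unfolding k_def add_mult_distrib by linarith
        then show ?thesis by (metis of_nat_le_iff of_nat_mult of_nat_numeral)
      qed
      have "T_count f m {1..int H} \<le> card {..<k} ^ 4 * M"
      proof (rule T_count_cover)
        show "finite (J i)" for i by (simp add: J_def)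
        show "{1..int H} \<subseteq> (\<Union>i\<in>{..<k}. J i)"
        proof
          fix x assume x: "x \<in> {1..int H}"
          define j where "j = nat (x - 1)"
          have "j \<le> H" unfolding j_def using x by auto
          then have "j div N < k" unfolding k_def using div_le_mono[of j H N] by simp
          moreover have "x \<in> J (j div N)"
          proof -
            have "int j = int (j div N * N) + int (j mod N)"
              by (metis div_mult_mod_eq of_nat_add)
            moreover have "int (j mod N) < int N" using N1 by simp
            moreover have "x = int j + 1" using x by (simp add: j_def)
            ultimately show ?thesis unfolding J_def atLeastAtMost_iff by linarith
          qed
          ultimately show "x \<in> (\<Union>i\<in>{..<k}. J i)" by blast
        qed
        fix i
        let ?f = "pcompose f [:int (i * N), 1:]"
        have deg: "degree ?f = d" using f by (simp add: degree_pcompose)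
        \<comment> \<open>A translation is monic of degree 1, so the leading coefficient stays
          coprime to \<open>m\<close>.\<close>
        have "lead_coeff ?f = lead_coeff f" by (subst lead_coeff_comp) auto
        then have "coeff ?f d = coeff f d" using deg f(1) by simp
        then show "T_count f m (J i) \<le> M"
          unfolding M_def J_def T_count_shift
          using block[OF deg, of N] f(2) N1 by (intro le_nat_floor) simp
      qed simp
      then have "real (T_count f m {1..int H}) \<le> real (k ^ 4 * M)" by (simp only: of_nat_le_iff card_lessThan)
      also have "\<dots> = real k ^ 4 * real M" by simp
      also have "\<dots> \<le> real k ^ 4 * (C * real N ^ 2 * real N powr \<epsilon>)"
        unfolding M_def using C by (intro mult_left_mono of_nat_floor) auto
      \<comment> \<open>Writing \<open>k ^ 4 * N ^ 2\<close> as \<open>(k * N) ^ 4 / N ^ 2\<close>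
        exposes \<open>H ^ 4\<close> over the square of the block length, which is of order
        \<open>m powr (2 * \<theta>)\<close>.\<close>
      also have "\<dots> = (real k * real N) ^ 4 * (C * real N powr \<epsilon>) / real N ^ 2"
        using N1 by (simp add: field_simps power2_eq_square power4_eq_xxxx)
      also have "\<dots> \<le> (2 * real H) ^ 4 * (C * real H powr \<epsilon>) / (R / 2) ^ 2"
      proof (intro frac_le mult_mono)
        show "(real k * real N) ^ 4 \<le> (2 * real H) ^ 4" by (rule power_mono[OF kN]) simp
        show "real N powr \<epsilon> \<le> real H powr \<epsilon>" using False assms(2) by (intro powr_mono2) auto
        show "(R / 2) ^ 2 \<le> real N ^ 2" using RN R0 by (intro power_mono) auto
      qed (use C R0 in auto)
      also have "\<dots> = 64 * real H ^ 4 * (C * real H powr \<epsilon>) / R ^ 2"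
        by (simp add: power_mult_distrib power_divide)
      also have "R ^ 2 = real m powr (2 * \<theta>) / c powr (2 * \<theta>)"
        using m c by (simp add: R_def powr_divide powr_realpow[symmetric] powr_powr mult.commute)
      also have "64 * real H ^ 4 * (C * real H powr \<epsilon>) / (real m powr (2 * \<theta>) / c powr (2 * \<theta>))
          = real H ^ 4 / real m powr (2 * \<theta>) * ((64 * C * c powr (2 * \<theta>)) * real H powr \<epsilon>)"
        using m c by (simp add: field_simps)
      also have "\<dots> \<le> (real H ^ 4 / real m powr (2 * \<theta>) + real H ^ 2) * (C' * real H powr \<epsilon>)"
        using C Hm by (intro mult_mono mult_right_mono) (auto simp: C'_def)
      finally show ?thesis .
    qed
  qed
  moreover have "2 * \<theta> = 4 / (real d * (real d + 1))" by (simp add: \<theta>_def)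
  ultimately show ?thesis by (intro exI[of _ C']) auto
qed

end
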